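(* Let $G$ be a connected $k$-regular graph on $n$ vertices with $k \geq 2$, let $A$ be its adjacency matrix, and let $U = U(G)$ be the transition matrix of the discrete-time quantum walk on $G$. Then the $nk$ eigenvalues of the positive support $S^+(U)$, counted with algebraic multiplicity, are the following: (i) $k-1$ with multiplicity $1$; (ii) $\dfrac{\lambda \pm \sqrt{\lambda^2 - 4(k-1)}}{2}$ (both signs) as $\lambda$ ranges over the eigenvalues of $A$, counted with multiplicity, with $\lambda \neq k$; (iii) $1$ with multiplicity $\dfrac{n(k-2)}{2} + 1$; (iv) $-1$ with multiplicity $\dfrac{n(k-2)}{2}$.
   Context: Graphs are finite, undirected and simple. The arcs of $G$ are the ordered pairs $uv$ with $u$ adjacent to $v$ (each edge gives two arcs; a $k$-regular graph on $n$ vertices has $nk$ arcs); $u$ is the tail and $v$ the head of $uv$. The transition matrix $U = U(G)$ has rows and columns indexed by the arcs of $G$, with entries $$U_{wx,uv} = \begin{cases} \frac{2}{d(v)} & \text{if } v = w \text{ and } u \neq x,\\ \frac{2}{d(v)} - 1 & \text{if } v = w \text{ and } u = x,\\ 0 & \text{otherwise,}\end{cases}$$ where $d(v)$ is the degree of $v$. For a real matrix $M$, the positive support $S^+(M)$ is the $0/1$-matrix of the same size with $(S^+(M))_{i,j} = 1$ if $M_{i,j} > 0$ and $0$ otherwise. Convention: the list of eigenvalues is a multiset (the roots of the characteristic polynomial over $\mathbb{C}$); if values from different items of the list coincide, their multiplicities are added. When $\lambda^2 < 4(k-1)$ the square root is a complex square root. *)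

theory Defs
  imports
    "Graph_Theory.Digraph_Component"
    "Jordan_Normal_Form.Char_Poly"
    "HOL-Computational_Algebra.Fundamental_Theorem_Algebra"
begin

text \<open>
  A finite simple undirected graph is a \<^locale>\<open>pair_graph\<close>: a finite loop-free digraph with
  symmetric arc relation, where each arc is the pair (tail, head). Hence \<^term>\<open>parcs G\<close> is
  exactly the set of ordered pairs of adjacent vertices, and the degree of a vertex is its
  out-degree.
\<close>

definition degree_of :: "'a pair_pre_digraph \<Rightarrow> 'a \<Rightarrow> nat" where
  "degree_of G v = out_degree (with_proj G) v"

definition regular_graph :: "'a pair_pre_digraph \<Rightarrow> nat \<Rightarrow> bool" where
  "regular_graph G k \<longleftrightarrow> (\<forall>v \<in> pverts G. degree_of G v = k)"

text \<open>
  Matrices are indexed by positions in a list: \<open>vs\<close> is meant to enumerate the vertices and \<open>es\<close>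
  the arcs of the graph, each without repetition.
\<close>

definition adjacency_matrix :: "'a pair_pre_digraph \<Rightarrow> 'a list \<Rightarrow> real mat" where
  "adjacency_matrix G vs =
     mat (length vs) (length vs) (\<lambda>(i, j). if (vs ! i, vs ! j) \<in> parcs G then 1 else 0)"

fun transition_entry :: "'a pair_pre_digraph \<Rightarrow> 'a \<times> 'a \<Rightarrow> 'a \<times> 'a \<Rightarrow> real" where
  "transition_entry G (w, x) (u, v) =
     (if v = w \<and> u \<noteq> x then 2 / real (degree_of G v)
      else if v = w \<and> u = x then 2 / real (degree_of G v) - 1
      else 0)"

definition transition_matrix :: "'a pair_pre_digraph \<Rightarrow> ('a \<times> 'a) list \<Rightarrow> real mat" where
  "transition_matrix G es =
     mat (length es) (length es) (\<lambda>(i, j). transition_entry G (es ! i) (es ! j))"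

definition positive_support :: "real mat \<Rightarrow> real mat" where
  "positive_support M = map_mat (\<lambda>x. if x > 0 then 1 else 0) M"

definition complex_eigenvalues :: "real mat \<Rightarrow> complex multiset" where
  "complex_eigenvalues M = proots (char_poly (map_mat complex_of_real M))"

end

theory Submission
  imports Defs
begin

text \<open>
  For \<open>k \<ge> 2\<close> the positive support of the transition matrix is the non-backtracking matrix
  \<open>B = S H - J\<close>, where \<open>S\<close> and \<open>H\<close> are the arc-tail and head-arc incidence matrices and \<open>J\<close>
  reverses arcs. Since \<open>(z + J) (z - J) = z\<^sup>2 - 1\<close> and \<open>H (z - J) S = z A - k\<close>, multiplying
  \<open>z - B\<close> by \<open>z - J\<close> and applying Sylvester's determinant identity gives the Ihara--Bass formula
  \<open>det (z - B) = (z\<^sup>2 - 1)\<^bsup>n(k-2)/2\<^esup> \<Prod>\<^sub>\<lambda> (z\<^sup>2 - \<lambda> z + k - 1)\<close>. The factor for \<open>\<lambda> = k\<close> is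
  \<open>(z - 1) (z - (k - 1))\<close>, and it occurs exactly once: if \<open>E\<close> is the all-ones matrix, then
  \<open>(z - k) det (z - A - E) = (z - k - n) det (z - A)\<close>, and by connectedness \<open>k\<close> is not an eigenvalue
  of \<open>A + E\<close>.
\<close>

section \<open>Determinants and characteristic polynomials\<close>

lemma poly_char_poly_eq_det:
  fixes A :: "'a :: comm_ring_1 mat"
  assumes "A \<in> carrier_mat n n"
  shows "poly (char_poly A) z = det (z \<cdot>\<^sub>m 1\<^sub>m n - A)"
  unfolding char_poly_def
  by (rule poly_det_cong[of _ n]) (use assms in \<open>auto simp: char_poly_matrix_def\<close>)

lemma index_mult_mat_sum:
  assumes "A \<in> carrier_mat n m" and "B \<in> carrier_mat m p" and "i < n" and "j < p"
  shows "(A * B) $$ (i, j) = (\<Sum>l<m. A $$ (i, l) * B $$ (l, j))"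
  using assms by (auto simp: scalar_prod_def atLeast0LessThan intro!: sum.cong)

text \<open>Sylvester's identity, kept free of division by the powers of \<open>c\<close>. The
  determinant of the block matrix \<open>?M\<close> is evaluated twice: \<open>?L\<close> has
  determinant 1 and clears the lower left block, \<open>?R\<close> has determinant
  \<open>c ^ n\<close> and clears the upper right one.\<close>

lemma det_scalar_minus_mult_commute:
  fixes X Y :: "'a :: idom mat"
  assumes X: "X \<in> carrier_mat N n" and Y: "Y \<in> carrier_mat n N"
  shows "c ^ n * det (c \<cdot>\<^sub>m 1\<^sub>m N - X * Y) = c ^ N * det (c \<cdot>\<^sub>m 1\<^sub>m n - Y * X)"
proof -
  let ?M = "four_block_mat (c \<cdot>\<^sub>m 1\<^sub>m N) X Y (1\<^sub>m n)"
  let ?L = "four_block_mat (1\<^sub>m N) (0\<^sub>m N n) (- Y) (1\<^sub>m n)"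
  let ?R = "four_block_mat (1\<^sub>m N) (- X) (0\<^sub>m n N) (c \<cdot>\<^sub>m 1\<^sub>m n)"
  have XY: "X * Y \<in> carrier_mat N N" and YX: "Y * X \<in> carrier_mat n n"
    using X Y by auto
  have M: "?M \<in> carrier_mat (N + n) (N + n)" and L: "?L \<in> carrier_mat (N + n) (N + n)"
    and R: "?R \<in> carrier_mat (N + n) (N + n)"
    by (auto intro!: four_block_carrier_mat)
  have "?M * ?L = four_block_mat (c \<cdot>\<^sub>m 1\<^sub>m N - X * Y) X (0\<^sub>m n N) (1\<^sub>m n)"
    by (subst mult_four_block_mat[of _ N N _ n _ n _ _ N _ n], use X Y XY in auto)
  moreover have "det ?L = 1"
    by (subst det_four_block_mat_upper_right_zero[of _ N _ n]) (use Y in auto)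
  ultimately have 1: "det ?M = det (c \<cdot>\<^sub>m 1\<^sub>m N - X * Y)"
    using det_mult[OF M L] det_four_block_mat_lower_left_zero[of "c \<cdot>\<^sub>m 1\<^sub>m N - X * Y" N X n
        "0\<^sub>m n N" "1\<^sub>m n"] X minus_carrier_mat[OF XY] by simp
  have "X * (c \<cdot>\<^sub>m 1\<^sub>m n) = c \<cdot>\<^sub>m X"
    using X mult_smult_distrib[of X N n "1\<^sub>m n" n c] by simp
  moreover have "c \<cdot>\<^sub>m 1\<^sub>m N * - X = - (c \<cdot>\<^sub>m X)"
    using X mult_smult_assoc_mat[of "1\<^sub>m N" N N "- X" n c] by auto
  ultimately have "?M * ?R = four_block_mat (c \<cdot>\<^sub>m 1\<^sub>m N) (0\<^sub>m N n) Y (c \<cdot>\<^sub>m 1\<^sub>m n - Y * X)"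
    by (subst mult_four_block_mat[of _ N N _ n _ n _ _ N _ n], use X Y YX in \<open>auto intro!: eq_matI\<close>)
  moreover have "det ?R = c ^ n"
    by (subst det_four_block_mat_lower_left_zero[of _ N _ n]) (use X in auto)
  ultimately have 2: "det ?M * c ^ n = c ^ N * det (c \<cdot>\<^sub>m 1\<^sub>m n - Y * X)"
    using det_mult[OF M R]
      det_four_block_mat_upper_right_zero[of "c \<cdot>\<^sub>m 1\<^sub>m N" N "0\<^sub>m N n" n Y "c \<cdot>\<^sub>m 1\<^sub>m n - Y * X"]
      Y minus_carrier_mat[OF YX] by simp
  from 1 2 show ?thesis by (simp add: mult.commute)
qed

text \<open>The signs form a diagonal matrix that is its own inverse, so this is a conjugation. In
  the Leibniz expansion each index contributes its sign once as a row and once as a column.\<close>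

lemma det_sign_conjugate:
  fixes A :: "'a :: comm_ring_1 mat"
  assumes A: "A \<in> carrier_mat n n" and d: "\<And>i. i < n \<Longrightarrow> d i * d i = 1"
  shows "det (mat n n (\<lambda>(i, j). d i * A $$ (i, j) * d j)) = det A"
proof -
  have "(\<Prod>i = 0..<n. d i * A $$ (i, p i) * d (p i)) = (\<Prod>i = 0..<n. A $$ (i, p i))"
    if p: "p permutes {0..<n}" for p
  proof -
    have "(\<Prod>i = 0..<n. d (p i)) = (\<Prod>i = 0..<n. d i)"
      using prod.permute[OF p, of d] by simp
    then have "(\<Prod>i = 0..<n. d i * A $$ (i, p i) * d (p i))
        = (\<Prod>i = 0..<n. d i * d i) * (\<Prod>i = 0..<n. A $$ (i, p i))"
      by (simp add: prod.distrib mult_ac)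
    also have "(\<Prod>i = 0..<n. d i * d i) = 1"
      using d by (intro prod.neutral) auto
    finally show ?thesis by simp
  qed
  moreover have "(\<Prod>i = 0..<n. mat n n (\<lambda>(i, j). d i * A $$ (i, j) * d j) $$ (i, p i))
      = (\<Prod>i = 0..<n. d i * A $$ (i, p i) * d (p i))" if "p permutes {0..<n}" for p
    using that by (intro prod.cong) auto
  ultimately show ?thesis
    by (subst (1 2) det_def'[of _ n]) (use A in \<open>auto intro!: sum.cong\<close>)
qed

text \<open>The set \<open>F\<close> holds the points where a factor to be cancelled, or a
  denominator, vanishes.\<close>

lemma poly_eqI_cofinite:
  fixes p q :: "'a :: {idom, ring_char_0} poly"
  assumes "finite F" and "\<And>z. z \<notin> F \<Longrightarrow> poly p z = poly q z"
  shows "p = q"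
proof (rule ccontr)
  assume "p \<noteq> q"
  then have "finite {z. poly (p - q) z = 0}"
    by (intro poly_roots_finite) simp
  moreover have "UNIV \<subseteq> F \<union> {z. poly (p - q) z = 0}"
    using assms(2) by auto
  ultimately have "finite (UNIV :: 'a set)"
    using assms(1) by (meson finite_Un finite_subset)
  then show False using infinite_UNIV_char_0 by blast
qed

text \<open>Constant row sums mean \<open>A E = k E\<close> for the all-ones matrix
  \<open>E\<close>, whence \<open>(z - A) ((z - k) - E) = (z - k) (z - A - E)\<close>. Adding
  \<open>E\<close> thus moves one eigenvalue from \<open>k\<close> to \<open>k + n\<close> and keeps
  the others.\<close>

lemma char_poly_add_ones:
  fixes A :: "'a :: field_char_0 mat"
  assumes A: "A \<in> carrier_mat n n" and row: "\<And>i. i < n \<Longrightarrow> (\<Sum>j<n. A $$ (i, j)) = k"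
  shows "[:- k, 1:] * char_poly (A + mat n n (\<lambda>_. 1)) = [:- (k + of_nat n), 1:] * char_poly A"
proof (rule poly_eqI_cofinite[of "{k}"])
  fix z assume z: "z \<notin> {k}"
  define E :: "'a mat" where "E = mat n n (\<lambda>_. 1)"
  have E: "E \<in> carrier_mat n n" by (simp add: E_def)
  have zA: "z \<cdot>\<^sub>m 1\<^sub>m n - A \<in> carrier_mat n n" using A by auto
  have "(z \<cdot>\<^sub>m 1\<^sub>m n - A) * ((z - k) \<cdot>\<^sub>m 1\<^sub>m n - E) = (z - k) \<cdot>\<^sub>m (z \<cdot>\<^sub>m 1\<^sub>m n - (A + E))"
    (is "?L = ?R")
  proof (rule eq_matI)
    fix i j assume "i < dim_row ?R" and "j < dim_col ?R"
    then have ij: "i < n" "j < n" using A E by auto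
    \<comment> \<open>Right multiplication by \<open>c I - E\<close> scales a row by
      \<open>c\<close> and subtracts the sum of the row from each entry.\<close>
    have *: "(\<Sum>l<n. f l * (c * of_bool (l = j) - 1)) = c * f j - (\<Sum>l<n. f l)"
      for f :: "nat \<Rightarrow> 'a" and c
    proof -
      have "(\<Sum>l<n. f l * (c * of_bool (l = j) - 1)) = (\<Sum>l<n. (if l = j then c * f l else 0) - f l)"
        by (intro sum.cong) (auto simp: algebra_simps)
      then show ?thesis using ij by (simp add: sum_subtractf)
    qed
    have "((z \<cdot>\<^sub>m 1\<^sub>m n - A) * ((z - k) \<cdot>\<^sub>m 1\<^sub>m n - E)) $$ (i, j)
        = (\<Sum>l<n. (z * of_bool (i = l) - A $$ (i, l)) * ((z - k) * of_bool (l = j) - 1))"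
      using A ij by (subst index_mult_mat_sum[of _ n n _ n]) (auto simp: E_def intro!: sum.cong)
    also have "\<dots> = (z - k) * (z * of_bool (i = j) - A $$ (i, j))
        - (\<Sum>l<n. z * of_bool (i = l) - A $$ (i, l))"
      by (rule *)
    also have "(\<Sum>l<n. z * of_bool (i = l) - A $$ (i, l)) = z - k"
      using ij row[of i] sum.delta'[of "{..<n}" i "\<lambda>_. z"]
      by (simp add: sum_subtractf of_bool_def if_distrib[of "\<lambda>x. z * x"] del: sum.delta'
          cong: if_cong)
    also have "(z - k) * (z * of_bool (i = j) - A $$ (i, j)) - (z - k) = ?R $$ (i, j)"
      using ij A by (cases "i = j") (simp_all add: E_def algebra_simps)
    finally show "?L $$ (i, j) = ?R $$ (i, j)" .
  qed (use A E in auto)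
  then have 1: "(z - k) ^ n * poly (char_poly (A + E)) z
      = poly (char_poly A) z * det ((z - k) \<cdot>\<^sub>m 1\<^sub>m n - E)"
    using det_mult[OF zA minus_carrier_mat[OF E], of "(z - k) \<cdot>\<^sub>m 1\<^sub>m n"] A E
    by (simp add: poly_char_poly_eq_det[of _ n])
  \<comment> \<open>\<open>E\<close> is a column times a row, so Sylvester's identity reduces the
    remaining determinant to that of a 1 by 1 matrix.\<close>
  let ?u = "mat n 1 (\<lambda>_. 1) :: 'a mat" and ?v = "mat 1 n (\<lambda>_. 1) :: 'a mat"
  have uv: "?u * ?v = E"
    by (rule eq_matI) (auto simp: E_def scalar_prod_def)
  have "?v * ?u = of_nat n \<cdot>\<^sub>m 1\<^sub>m 1"
    by (rule eq_matI) (auto simp: scalar_prod_def)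
  then have "det ((z - k) \<cdot>\<^sub>m 1\<^sub>m 1 - ?v * ?u) = z - k - of_nat n"
    by (subst det_single) auto
  then have 2: "(z - k) * det ((z - k) \<cdot>\<^sub>m 1\<^sub>m n - E) = (z - k) ^ n * (z - k - of_nat n)"
    using det_scalar_minus_mult_commute[of ?u n 1 ?v "z - k"] uv by simp
  have "(z - k) ^ n * ((z - k) * poly (char_poly (A + E)) z)
      = poly (char_poly A) z * ((z - k) * det ((z - k) \<cdot>\<^sub>m 1\<^sub>m n - E))"
    using 1 by (simp add: mult_ac)
  also have "\<dots> = (z - k) ^ n * ((z - k - of_nat n) * poly (char_poly A) z)"
    unfolding 2 by (simp add: mult_ac)
  finally have "(z - k) * poly (char_poly (A + E)) z = (z - k - of_nat n) * poly (char_poly A) z"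
    using z by simp
  then show "poly ([:- k, 1:] * char_poly (A + mat n n (\<lambda>_. 1))) z
      = poly ([:- (k + of_nat n), 1:] * char_poly A) z"
    by (simp add: E_def algebra_simps)
qed simp

text \<open>Discrete Dirichlet energy: after expanding \<open>a i j * (f i - f j)\<^sup>2\<close>,
  symmetry, the row sums and harmonicity make the total over all pairs vanish. Its terms are
  nonnegative, so each of them is zero.\<close>

lemma weighted_harmonic_imp_eq:
  fixes a :: "nat \<Rightarrow> nat \<Rightarrow> real"
  assumes nonneg: "\<And>i j. i < n \<Longrightarrow> j < n \<Longrightarrow> a i j \<ge> 0"
    and sym: "\<And>i j. i < n \<Longrightarrow> j < n \<Longrightarrow> a i j = a j i"
    and row: "\<And>i. i < n \<Longrightarrow> (\<Sum>j<n. a i j) = k"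
    and harm: "\<And>i. i < n \<Longrightarrow> (\<Sum>j<n. a i j * f j) = k * f i"
    and ij: "i < n" "j < n" "a i j \<noteq> 0"
  shows "f i = f j"
proof -
  let ?q = "\<lambda>i j. a i j * (f i - f j)\<^sup>2"
  have 1: "(\<Sum>i<n. \<Sum>j<n. a i j * (f i)\<^sup>2) = k * (\<Sum>i<n. (f i)\<^sup>2)"
    using row by (simp add: sum_distrib_left flip: sum_distrib_right)
  have "(\<Sum>i<n. \<Sum>j<n. a i j * (f j)\<^sup>2) = (\<Sum>i<n. \<Sum>j<n. a i j * (f i)\<^sup>2)"
    by (subst sum.swap) (auto intro!: sum.cong simp: sym)
  with 1 have 2: "(\<Sum>i<n. \<Sum>j<n. a i j * (f j)\<^sup>2) = k * (\<Sum>i<n. (f i)\<^sup>2)" by simp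
  have "(\<Sum>i<n. \<Sum>j<n. a i j * (f i * f j)) = (\<Sum>i<n. f i * (\<Sum>j<n. a i j * f j))"
    by (simp add: sum_distrib_left mult_ac)
  also have "\<dots> = k * (\<Sum>i<n. (f i)\<^sup>2)"
    using harm by (simp add: sum_distrib_left power2_eq_square mult_ac)
  finally have 3: "(\<Sum>i<n. \<Sum>j<n. a i j * (f i * f j)) = k * (\<Sum>i<n. (f i)\<^sup>2)" .
  have "(\<Sum>i<n. \<Sum>j<n. ?q i j) = (\<Sum>i<n. \<Sum>j<n. a i j * (f i)\<^sup>2 + a i j * (f j)\<^sup>2
      - 2 * (a i j * (f i * f j)))"
    by (intro sum.cong refl) (simp add: power2_eq_square algebra_simps)
  also have "\<dots> = 0"
    using 1 2 3 by (simp add: sum_subtractf sum.distrib flip: sum_distrib_left)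
  finally have "(\<Sum>i<n. \<Sum>j<n. ?q i j) = 0" .
  then have "(\<Sum>j<n. ?q i j) = 0"
    using nonneg ij by (subst (asm) sum_nonneg_eq_0_iff) (auto intro!: sum_nonneg)
  then have "?q i j = 0"
    using nonneg ij by (subst (asm) sum_nonneg_eq_0_iff) auto
  then show ?thesis using ij by simp
qed

text \<open>The algebraic multiplicity is found without diagonalizing \<open>A\<close>, by comparing
  orders at \<open>k\<close> in \<open>char_poly_add_ones\<close>. It remains to see that
  \<open>k\<close> is not an eigenvalue of \<open>A + E\<close>; the assumption \<open>const\<close>
  is what connectedness will supply.\<close>

lemma order_char_poly_simple_eigenvalue:
  fixes A :: "real mat"
  assumes A: "A \<in> carrier_mat n n" and n: "n > 0"
    and sym: "\<And>i j. i < n \<Longrightarrow> j < n \<Longrightarrow> A $$ (i, j) = A $$ (j, i)"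
    and row: "\<And>i. i < n \<Longrightarrow> (\<Sum>j<n. A $$ (i, j)) = k"
    and const: "\<And>f i j. (\<And>i. i < n \<Longrightarrow> (\<Sum>j<n. A $$ (i, j) * f j) = k * f i) \<Longrightarrow>
      i < n \<Longrightarrow> j < n \<Longrightarrow> f i = f j"
  shows "order (complex_of_real k) (char_poly (map_mat complex_of_real A)) = 1"
proof -
  let ?AE = "A + mat n n (\<lambda>_. 1)"
  have AE: "?AE \<in> carrier_mat n n" using A by auto
  have nz: "poly (char_poly ?AE) k \<noteq> 0"
  proof
    assume "poly (char_poly ?AE) k = 0"
    then obtain w where w: "w \<in> carrier_vec n" "w \<noteq> 0\<^sub>v n" "?AE *\<^sub>v w = k \<cdot>\<^sub>v w"
      using eigenvalue_root_char_poly[OF AE, of k] A unfolding eigenvalue_def eigenvector_def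
      by auto
    \<comment> \<open>Summing the eigenvector equation over all rows, with column sums
      \<open>k\<close> by symmetry, gives \<open>k s + n s = k s\<close>, so \<open>s = 0\<close>.
      Then \<open>w\<close> is harmonic for \<open>A\<close>, hence constant, and a constant vector
      with sum 0 vanishes.\<close>
    let ?s = "\<Sum>j<n. w $ j"
    have eq: "(\<Sum>j<n. A $$ (i, j) * w $ j) + ?s = k * w $ i" if i: "i < n" for i
    proof -
      have "k * w $ i = (?AE *\<^sub>v w) $ i" using w i by simp
      also have "\<dots> = (\<Sum>j<n. (A $$ (i, j) + 1) * w $ j)"
        using A w(1) i by (auto simp: scalar_prod_def atLeast0LessThan intro!: sum.cong)
      finally show ?thesis by (simp add: algebra_simps sum.distrib)
    qed
    have "(\<Sum>i<n. \<Sum>j<n. A $$ (i, j) * w $ j) = (\<Sum>j<n. (\<Sum>i<n. A $$ (j, i)) * w $ j)"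
      by (subst sum.swap) (auto simp: sum_distrib_right sym intro!: sum.cong)
    also have "\<dots> = k * ?s" using row by (simp add: sum_distrib_left)
    finally have "(\<Sum>i<n. \<Sum>j<n. A $$ (i, j) * w $ j) = k * ?s" .
    moreover have "(\<Sum>i<n. (\<Sum>j<n. A $$ (i, j) * w $ j) + ?s) = (\<Sum>i<n. k * w $ i)"
      using eq by simp
    ultimately have "k * ?s + n * ?s = k * ?s"
      by (simp only: sum.distrib sum_distrib_left[symmetric] sum_constant card_lessThan)
    then have s: "?s = 0" using n by simp
    then have c: "w $ i = w $ 0" if "i < n" for i
      using const[of "\<lambda>j. w $ j" i 0] eq that n by simp
    have "?s = (\<Sum>j<n. w $ 0)" by (intro sum.cong refl c) simp
    with s n have "w $ 0 = 0" by simp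
    with c have "w $ i = 0" if "i < n" for i using that by metis
    then have "w = 0\<^sub>v n" using w(1) by (intro eq_vecI) auto
    with w(2) show False by simp
  qed
  \<comment> \<open>\<open>const\<close> speaks of real functions, so nonvanishing was shown over
    the reals; it is now carried to the complex numbers, where the orders are compared.\<close>
  let ?A = "map_mat complex_of_real A" and ?k = "complex_of_real k"
  have A': "?A \<in> carrier_mat n n" using A by simp
  have "poly (char_poly (map_mat complex_of_real ?AE)) ?k = of_real (poly (char_poly ?AE) k)"
    unfolding of_real_hom.char_poly_hom[OF AE] by (rule of_real_hom.poly_map_poly)
  moreover have "map_mat complex_of_real ?AE = ?A + mat n n (\<lambda>_. 1)"
    using A by (intro eq_matI) auto
  ultimately have nz': "poly (char_poly (?A + mat n n (\<lambda>_. 1))) ?k \<noteq> 0"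
    using nz by (simp only: of_real_eq_0_iff not_False_eq_True)
  have "(\<Sum>j<n. ?A $$ (i, j)) = ?k" if "i < n" for i
  proof -
    have "(\<Sum>j<n. ?A $$ (i, j)) = (\<Sum>j<n. of_real (A $$ (i, j)))"
      using A that by (intro sum.cong) auto
    then show ?thesis using row[OF that] by (simp only: of_real_sum[symmetric])
  qed
  from char_poly_add_ones[OF A' this]
  have eq: "[:- ?k, 1:] * char_poly (?A + mat n n (\<lambda>_. 1))
    = [:- (?k + of_nat n), 1:] * char_poly ?A" .
  have nz1: "char_poly (?A + mat n n (\<lambda>_. 1)) \<noteq> 0" using nz' by auto
  have nz2: "char_poly ?A \<noteq> 0"
    using degree_monic_char_poly[OF A'] by (metis coeff_0 zero_neq_one)
  have "order ?k [:- ?k, 1:] = 1"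
    using order_power_n_n[of ?k 1] by simp
  moreover have "order ?k (char_poly (?A + mat n n (\<lambda>_. 1))) = 0"
    using nz' by (rule order_0I)
  \<comment> \<open>\<open>n > 0\<close> separates \<open>k + n\<close> from
    \<open>k\<close>.\<close>
  moreover have "order ?k [:- (?k + of_nat n), 1:] = 0"
    using n by (intro order_0I) simp
  ultimately show ?thesis
    using arg_cong[OF eq, of "order ?k"] nz1 nz2 by (simp add: order_mult del: mult_pCons_left)
qed

section \<open>The Ihara--Bass formula for regular multigraphs\<close>

text \<open>
  Vertices are \<open>0, \<dots>, n - 1\<close> and arcs are \<open>0, \<dots>, N - 1\<close>; arc \<open>i\<close> has tail \<open>t i\<close> and reverse
  \<open>\<sigma> i\<close>, hence head \<open>t (\<sigma> i)\<close>.
\<close>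

definition regular_multigraph ::
    "nat \<Rightarrow> nat \<Rightarrow> nat \<Rightarrow> (nat \<Rightarrow> nat) \<Rightarrow> (nat \<Rightarrow> nat) \<Rightarrow> bool" where
  "regular_multigraph N n k t \<sigma> \<longleftrightarrow>
    (\<forall>i<N. t i < n \<and> \<sigma> i < N \<and> \<sigma> (\<sigma> i) = i \<and> \<sigma> i \<noteq> i) \<and>
    (\<forall>v<n. card {i. i < N \<and> t i = v} = k)"

context
  fixes N n k :: nat and t \<sigma> :: "nat \<Rightarrow> nat"
begin

text \<open>Entries count arcs, so parallel edges are covered with their multiplicity.\<close>

definition adj_mat :: "'a :: comm_ring_1 mat" where
  "adj_mat = mat n n (\<lambda>(u, v). of_nat (card {i. i < N \<and> t i = u \<and> t (\<sigma> i) = v}))"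

text \<open>The non-backtracking matrix: column \<open>j\<close> is the current arc and row
  \<open>i\<close> a possible next one, the reverse of \<open>j\<close> being excluded.\<close>

definition hashimoto_mat :: "'a :: comm_ring_1 mat" where
  "hashimoto_mat = mat N N (\<lambda>(i, j). if t i = t (\<sigma> j) \<and> j \<noteq> \<sigma> i then 1 else 0)"

definition rev_mat :: "'a :: comm_ring_1 mat" where
  "rev_mat = mat N N (\<lambda>(i, j). if j = \<sigma> i then 1 else 0)"

definition tail_mat :: "'a :: comm_ring_1 mat" where
  "tail_mat = mat N n (\<lambda>(i, v). if t i = v then 1 else 0)"

definition head_mat :: "'a :: comm_ring_1 mat" where
  "head_mat = mat n N (\<lambda>(v, i). if t (\<sigma> i) = v then 1 else 0)"

lemma mat_carriers [simp]:
  "adj_mat \<in> carrier_mat n n" "hashimoto_mat \<in> carrier_mat N N" "rev_mat \<in> carrier_mat N N"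
  "tail_mat \<in> carrier_mat N n" "head_mat \<in> carrier_mat n N"
  by (simp_all add: adj_mat_def hashimoto_mat_def rev_mat_def tail_mat_def head_mat_def)

lemma mat_dims [simp]:
  "dim_row adj_mat = n" "dim_col adj_mat = n" "dim_row hashimoto_mat = N"
  "dim_col hashimoto_mat = N" "dim_row rev_mat = N" "dim_col rev_mat = N"
  "dim_row tail_mat = N" "dim_col tail_mat = n" "dim_row head_mat = n" "dim_col head_mat = N"
  by (simp_all add: adj_mat_def hashimoto_mat_def rev_mat_def tail_mat_def head_mat_def)

context
  assumes multigraph: "regular_multigraph N n k t \<sigma>"
begin

lemma tail_less: "i < N \<Longrightarrow> t i < n"
  and rev_less: "i < N \<Longrightarrow> \<sigma> i < N"
  and rev_rev: "i < N \<Longrightarrow> \<sigma> (\<sigma> i) = i"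
  and rev_neq: "i < N \<Longrightarrow> \<sigma> i \<noteq> i"
  and regular: "v < n \<Longrightarrow> card {i. i < N \<and> t i = v} = k"
  using multigraph unfolding regular_multigraph_def by blast+

text \<open>Reversal exchanges heads and tails, so counts by head become counts by tail.\<close>

lemma bij_betw_rev_subset: "bij_betw \<sigma> {i. i < N \<and> P (\<sigma> i)} {i. i < N \<and> P i}"
  by (rule bij_betwI[where g = \<sigma>]) (auto simp: rev_less rev_rev)

lemma card_arcs: "N = n * k"
proof -
  have "{..<N} = (\<Union>v<n. {i. i < N \<and> t i = v})"
    using tail_less by auto
  then have "card {..<N} = card (\<Union>v<n. {i. i < N \<and> t i = v})"
    by (rule arg_cong)
  also have "\<dots> = (\<Sum>v<n. card {i. i < N \<and> t i = v})"
    by (intro card_UN_disjoint) auto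
  finally show ?thesis using regular by simp
qed

section \<open>Reversal and incidence matrices, and the determinants built from them\<close>

lemma rev_mat_mult:
  assumes "A \<in> carrier_mat N m" "i < N" "j < m"
  shows "(rev_mat * A) $$ (i, j) = A $$ (\<sigma> i, j)"
proof -
  have "(rev_mat * A) $$ (i, j) = (\<Sum>l<N. (if l = \<sigma> i then 1 else 0) * A $$ (l, j))"
    using assms by (subst index_mult_mat_sum[of _ N N _ m]) (auto simp: rev_mat_def intro!: sum.cong)
  also have "\<dots> = (\<Sum>l<N. if l = \<sigma> i then A $$ (l, j) else 0)"
    by (intro sum.cong) auto
  finally show ?thesis using rev_less assms by simp
qed

lemma rev_mat_mult_self: "rev_mat * rev_mat = 1\<^sub>m N"
proof (rule eq_matI; (simp; fail)?)
  fix i j :: nat assume "i < dim_row (1\<^sub>m N)" "j < dim_col (1\<^sub>m N)"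
  then have "i < N" "j < N" by auto
  then show "(rev_mat * rev_mat) $$ (i, j) = 1\<^sub>m N $$ (i, j)"
    by (subst rev_mat_mult[of _ N]) (auto simp: rev_mat_def rev_less rev_rev)
qed

lemma char_rev_carrier [simp]: "z \<cdot>\<^sub>m 1\<^sub>m N - rev_mat \<in> carrier_mat N N"
  by (intro minus_carrier_mat) simp

lemma rev_mat_factorization:
  "(z \<cdot>\<^sub>m 1\<^sub>m N + rev_mat) * (z \<cdot>\<^sub>m 1\<^sub>m N - rev_mat) = (z\<^sup>2 - 1) \<cdot>\<^sub>m 1\<^sub>m N"
proof -
  note Z = char_rev_carrier[of z]
  have 1: "z \<cdot>\<^sub>m 1\<^sub>m N * (z \<cdot>\<^sub>m 1\<^sub>m N - rev_mat) = z \<cdot>\<^sub>m (z \<cdot>\<^sub>m 1\<^sub>m N - rev_mat)"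
    using mult_smult_assoc_mat[OF one_carrier_mat Z, of z] left_mult_one_mat[OF Z] by simp
  have "rev_mat * (z \<cdot>\<^sub>m 1\<^sub>m N - rev_mat) = rev_mat * (z \<cdot>\<^sub>m 1\<^sub>m N) - rev_mat * rev_mat"
    by (rule mult_minus_distrib_mat) auto
  also have "rev_mat * (z \<cdot>\<^sub>m 1\<^sub>m N) = z \<cdot>\<^sub>m rev_mat"
    using mult_smult_distrib[of rev_mat N N "1\<^sub>m N" N z] by simp
  finally have 2: "rev_mat * (z \<cdot>\<^sub>m 1\<^sub>m N - rev_mat) = z \<cdot>\<^sub>m rev_mat - 1\<^sub>m N"
    by (simp add: rev_mat_mult_self)
  have "(z \<cdot>\<^sub>m 1\<^sub>m N + rev_mat) * (z \<cdot>\<^sub>m 1\<^sub>m N - rev_mat)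
      = z \<cdot>\<^sub>m (z \<cdot>\<^sub>m 1\<^sub>m N - rev_mat) + (z \<cdot>\<^sub>m rev_mat - 1\<^sub>m N)"
    using add_mult_distrib_mat[OF _ _ Z, of "z \<cdot>\<^sub>m 1\<^sub>m N" N rev_mat] 1 2 by simp
  also have "\<dots> = (z\<^sup>2 - 1) \<cdot>\<^sub>m 1\<^sub>m N"
    by (rule eq_matI) (auto simp: algebra_simps power2_eq_square)
  finally show ?thesis .
qed

text \<open>\<open>S H\<close> marks the pairs where the head of \<open>j\<close> is the tail of
  \<open>i\<close>. The pair with \<open>j = \<sigma> i\<close> is always among them, so subtracting
  \<open>J\<close> removes exactly the backtracking.\<close>

lemma hashimoto_mat_eq:
  "(hashimoto_mat :: 'a :: comm_ring_1 mat) = tail_mat * head_mat - rev_mat" (is "_ = ?R")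
proof (rule eq_matI)
  fix i j assume "i < dim_row ?R" and "j < dim_col ?R"
  then have ij: "i < N" "j < N" by auto
  have "(tail_mat * head_mat) $$ (i, j)
      = (\<Sum>v<n. (if t i = v then 1 else 0) * (if t (\<sigma> j) = v then 1 else 0) :: 'a)"
    using ij by (subst index_mult_mat_sum[of _ N n _ N])
      (auto simp: tail_mat_def head_mat_def intro!: sum.cong)
  also have "\<dots> = (\<Sum>v<n. if t i = v then if t (\<sigma> j) = v then 1 else 0 else 0)"
    by (intro sum.cong) auto
  also have "\<dots> = (if t i = t (\<sigma> j) then 1 else 0)"
    using tail_less[OF ij(1)] by (auto simp: sum.delta')
  finally have TH: "(tail_mat * head_mat) $$ (i, j) = (if t i = t (\<sigma> j) then 1 else 0 :: 'a)" .
  have "?R $$ (i, j) = (tail_mat * head_mat) $$ (i, j) - rev_mat $$ (i, j)"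
    using ij by (intro index_minus_mat(1)) auto
  then show "hashimoto_mat $$ (i, j) = ?R $$ (i, j)"
    unfolding TH using ij by (auto simp: hashimoto_mat_def rev_mat_def rev_rev)
qed simp_all

text \<open>\<open>H S\<close> counts arcs from \<open>v\<close> to \<open>u\<close>, which reversal
  turns into \<open>A\<close>. In \<open>H J S\<close> the same head has to equal both
  \<open>u\<close> and \<open>v\<close>, so only the diagonal survives, and regularity makes it
  \<open>k\<close>.\<close>

lemma head_mat_rev_tail_mat:
  fixes z :: "'a :: comm_ring_1"
  shows "head_mat * (z \<cdot>\<^sub>m 1\<^sub>m N - rev_mat) * tail_mat = z \<cdot>\<^sub>m adj_mat - of_nat k \<cdot>\<^sub>m 1\<^sub>m n"
proof -
  note Z = char_rev_carrier[of z]
  have "(z \<cdot>\<^sub>m 1\<^sub>m N - rev_mat) * tail_mat = z \<cdot>\<^sub>m 1\<^sub>m N * tail_mat - rev_mat * tail_mat"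
    by (rule minus_mult_distrib_mat) auto
  also have "z \<cdot>\<^sub>m 1\<^sub>m N * tail_mat = z \<cdot>\<^sub>m tail_mat"
    using mult_smult_assoc_mat[of "1\<^sub>m N" N N tail_mat n z] by simp
  finally have ZT: "(z \<cdot>\<^sub>m 1\<^sub>m N - rev_mat) * tail_mat = z \<cdot>\<^sub>m tail_mat - rev_mat * tail_mat" .
  have "head_mat * ((z \<cdot>\<^sub>m 1\<^sub>m N - rev_mat) * tail_mat) = z \<cdot>\<^sub>m adj_mat - of_nat k \<cdot>\<^sub>m 1\<^sub>m n"
  proof (rule eq_matI; (simp; fail)?)
    fix u v assume "u < dim_row (z \<cdot>\<^sub>m adj_mat - of_nat k \<cdot>\<^sub>m 1\<^sub>m n)"
      and "v < dim_col (z \<cdot>\<^sub>m adj_mat - of_nat k \<cdot>\<^sub>m 1\<^sub>m n)"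
    then have uv: "u < n" "v < n" by auto
    have cnt: "(\<Sum>i<N. of_bool (P i)) = (of_nat (card {i. i < N \<and> P i}) :: 'a)" for P
      by (simp add: lessThan_def Collect_conj_eq)
    have 1: "card {i. i < N \<and> t (\<sigma> i) = u} = k"
      using bij_betw_same_card[OF bij_betw_rev_subset, of "\<lambda>i. t i = u"] regular[OF uv(1)]
      by simp
    have 2: "card {i. i < N \<and> (t (\<sigma> i) = u \<and> t i = v)}
        = card {i. i < N \<and> t i = u \<and> t (\<sigma> i) = v}"
      using bij_betw_same_card[OF bij_betw_rev_subset, of "\<lambda>i. t i = u \<and> t (\<sigma> i) = v"]
      by (simp add: rev_rev cong: conj_cong)
    have entry: "((z \<cdot>\<^sub>m 1\<^sub>m N - rev_mat) * tail_mat) $$ (i, v)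
        = z * (if t i = v then 1 else 0) - (if t (\<sigma> i) = v then 1 else 0)" if "i < N" for i
    proof -
      have "((z \<cdot>\<^sub>m 1\<^sub>m N - rev_mat) * tail_mat) $$ (i, v)
          = z * tail_mat $$ (i, v) - (rev_mat * tail_mat) $$ (i, v)"
        unfolding ZT using that uv by (simp del: index_mult_mat(1))
      then show ?thesis
        using rev_mat_mult[OF mat_carriers(4) that uv(2)] that uv rev_less
        by (simp add: tail_mat_def del: index_mult_mat)
    qed
    have "(head_mat * ((z \<cdot>\<^sub>m 1\<^sub>m N - rev_mat) * tail_mat)) $$ (u, v)
        = (\<Sum>i<N. (if t (\<sigma> i) = u then 1 else 0) *
            (z * (if t i = v then 1 else 0) - (if t (\<sigma> i) = v then 1 else 0)))"
      unfolding index_mult_mat_sum[OF mat_carriers(5) mult_carrier_mat[OF Z mat_carriers(4)] uv]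
      by (intro sum.cong refl) (simp add: entry uv head_mat_def del: index_mult_mat)
    also have "\<dots> = (\<Sum>i<N. z * of_bool (t (\<sigma> i) = u \<and> t i = v) -
        of_bool (u = v) * of_bool (t (\<sigma> i) = u))"
      by (intro sum.cong) auto
    also have "\<dots> = z * of_nat (card {i. i < N \<and> (t (\<sigma> i) = u \<and> t i = v)})
        - of_bool (u = v) * of_nat (card {i. i < N \<and> t (\<sigma> i) = u})"
      unfolding cnt[symmetric] by (simp only: sum_subtractf sum_distrib_left)
    also have "\<dots> = (z \<cdot>\<^sub>m adj_mat - of_nat k \<cdot>\<^sub>m 1\<^sub>m n) $$ (u, v)"
      unfolding 1 2 using uv by (simp add: adj_mat_def)
    finally show "(head_mat * ((z \<cdot>\<^sub>m 1\<^sub>m N - rev_mat) * tail_mat)) $$ (u, v)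
        = (z \<cdot>\<^sub>m adj_mat - of_nat k \<cdot>\<^sub>m 1\<^sub>m n) $$ (u, v)" .
  qed
  then show ?thesis
    using assoc_mult_mat[of head_mat n N "z \<cdot>\<^sub>m 1\<^sub>m N - rev_mat" N tail_mat n] by simp
qed

lemma det_rev_mat_sign:
  fixes z :: "'a :: comm_ring_1"
  shows "det (z \<cdot>\<^sub>m 1\<^sub>m N + rev_mat) = det (z \<cdot>\<^sub>m 1\<^sub>m N - rev_mat)"
proof -
  \<comment> \<open>Orient each edge by comparing the indices of its two arcs; conjugation by the
    orientation signs negates the reversal matrix.\<close>
  define d :: "nat \<Rightarrow> 'a" where "d i = (if i < \<sigma> i then 1 else - 1)" for i
  have "mat N N (\<lambda>(i, j). d i * (z \<cdot>\<^sub>m 1\<^sub>m N - rev_mat) $$ (i, j) * d j) = z \<cdot>\<^sub>m 1\<^sub>m N + rev_mat"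
  proof (rule eq_matI; (simp; fail)?)
    fix i j assume "i < dim_row (z \<cdot>\<^sub>m 1\<^sub>m N + rev_mat)" "j < dim_col (z \<cdot>\<^sub>m 1\<^sub>m N + rev_mat)"
    then have ij: "i < N" "j < N" by auto
    show "mat N N (\<lambda>(i, j). d i * (z \<cdot>\<^sub>m 1\<^sub>m N - rev_mat) $$ (i, j) * d j) $$ (i, j)
        = (z \<cdot>\<^sub>m 1\<^sub>m N + rev_mat) $$ (i, j)"
      using ij rev_neq[OF ij(1)] rev_less[OF ij(1)] rev_rev[OF ij(1)]
      by (cases "i < \<sigma> i") (auto simp: rev_mat_def d_def)
  qed
  then show ?thesis
    using det_sign_conjugate[of "z \<cdot>\<^sub>m 1\<^sub>m N - rev_mat" N d] by (simp add: d_def)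
qed

text \<open>Both factors of \<open>rev_mat_factorization\<close> have the same determinant, so its
  square is known. The sign of the root is settled for polynomials, by monicity.\<close>

lemma det_rev_mat_square: "(det (z \<cdot>\<^sub>m 1\<^sub>m N - rev_mat))\<^sup>2 = (z\<^sup>2 - 1) ^ N"
  using det_mult[of "z \<cdot>\<^sub>m 1\<^sub>m N + rev_mat" N "z \<cdot>\<^sub>m 1\<^sub>m N - rev_mat", symmetric]
  by (simp add: rev_mat_factorization det_rev_mat_sign power2_eq_square)

text \<open>Sylvester's identity with \<open>c = z\<^sup>2 - 1\<close> is applied to
  \<open>(z - B) (z - J) = c - S (H (z - J))\<close>, passing from arcs to vertices.\<close>

lemma det_hashimoto_mat:
  fixes z :: "'a :: idom"
  shows "(z\<^sup>2 - 1) ^ n * (det (z \<cdot>\<^sub>m 1\<^sub>m N - hashimoto_mat) * det (z \<cdot>\<^sub>m 1\<^sub>m N - rev_mat))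
    = (z\<^sup>2 - 1) ^ N * det ((z\<^sup>2 - 1 + of_nat k) \<cdot>\<^sub>m 1\<^sub>m n - z \<cdot>\<^sub>m adj_mat)"
proof -
  let ?Z = "z \<cdot>\<^sub>m 1\<^sub>m N - rev_mat"
  have Z: "?Z \<in> carrier_mat N N" and HZ: "head_mat * ?Z \<in> carrier_mat n N" by auto
  have TH: "tail_mat * head_mat \<in> carrier_mat N N" by auto
  have "z \<cdot>\<^sub>m 1\<^sub>m N - hashimoto_mat = z \<cdot>\<^sub>m 1\<^sub>m N + rev_mat - tail_mat * head_mat"
    unfolding hashimoto_mat_eq by (rule eq_matI) auto
  then have "(z \<cdot>\<^sub>m 1\<^sub>m N - hashimoto_mat) * ?Z
      = (z \<cdot>\<^sub>m 1\<^sub>m N + rev_mat) * ?Z - tail_mat * head_mat * ?Z"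
    using minus_mult_distrib_mat[OF _ TH Z, of "z \<cdot>\<^sub>m 1\<^sub>m N + rev_mat"] by simp
  then have "(z \<cdot>\<^sub>m 1\<^sub>m N - hashimoto_mat) * ?Z
      = (z\<^sup>2 - 1) \<cdot>\<^sub>m 1\<^sub>m N - tail_mat * (head_mat * ?Z)"
    using assoc_mult_mat[of tail_mat N n head_mat N ?Z N] by (simp add: rev_mat_factorization)
  then have "det (z \<cdot>\<^sub>m 1\<^sub>m N - hashimoto_mat) * det ?Z
      = det ((z\<^sup>2 - 1) \<cdot>\<^sub>m 1\<^sub>m N - tail_mat * (head_mat * ?Z))"
    using det_mult[of "z \<cdot>\<^sub>m 1\<^sub>m N - hashimoto_mat" N ?Z]
    by (simp add: minus_carrier_mat)
  moreover have "(z\<^sup>2 - 1) \<cdot>\<^sub>m 1\<^sub>m n - head_mat * ?Z * tail_mat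
      = (z\<^sup>2 - 1 + of_nat k) \<cdot>\<^sub>m 1\<^sub>m n - z \<cdot>\<^sub>m adj_mat"
    unfolding head_mat_rev_tail_mat by (rule eq_matI) (auto simp: algebra_simps)
  ultimately show ?thesis
    using det_scalar_minus_mult_commute[OF mat_carriers(4) HZ, of "z\<^sup>2 - 1"] by simp
qed

text \<open>The characteristic polynomial \<open>p\<close> of \<open>J\<close> satisfies
  \<open>p\<^sup>2 = (z\<^sup>2 - 1)\<^sup>N\<close>. Since 1 is a simple root of
  \<open>z\<^sup>2 - 1\<close>, its multiplicity in \<open>p\<close> is half of \<open>N\<close>, so
  \<open>N\<close> is even. Then \<open>p\<close> is a power of \<open>z\<^sup>2 - 1\<close> up to
  sign, and the leading coefficient fixes the sign.\<close>

lemma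
  shows even_arcs: "even N"
    and char_poly_rev_mat: "char_poly (rev_mat :: complex mat) = [:- 1, 0, 1:] ^ (N div 2)"
proof -
  let ?p = "char_poly (rev_mat :: complex mat)" and ?q = "[:- 1, 0, 1:] :: complex poly"
  have sq: "?p\<^sup>2 = ?q ^ N"
  proof (rule poly_eqI_cofinite[of "{}"])
    fix z :: complex
    show "poly (?p\<^sup>2) z = poly (?q ^ N) z"
      using det_rev_mat_square[of z]
      by (simp add: poly_char_poly_eq_det[of _ N] power2_eq_square)
  qed simp
  have monic: "lead_coeff ?p = 1"
    using degree_monic_char_poly[of "rev_mat :: complex mat" N] by simp
  then have nz: "?p \<noteq> 0" by auto
  have q: "?q = [:- 1, 1:] * [:1, 1:]" by simp
  have "order 1 ?q = 1"
    unfolding q using order_power_n_n[of "1 :: complex" 1] order_0I[of "[:1, 1:]" "1 :: complex"]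
    by (subst order_mult) auto
  then have "2 * order 1 ?p = N"
    using arg_cong[OF sq, of "\<lambda>p. count (proots p) 1"] nz by (simp add: proots_power)
  then show even: "even N" by presburger
  then have "?p\<^sup>2 = (?q ^ (N div 2))\<^sup>2"
    using sq by (simp flip: power_mult)
  then have "?p = ?q ^ (N div 2) \<or> ?p = - (?q ^ (N div 2))"
    by (simp add: power2_eq_iff)
  moreover have "lead_coeff (- (?q ^ (N div 2))) = - 1"
    by (simp only: lead_coeff_minus lead_coeff_power) simp
  then have "?p \<noteq> - (?q ^ (N div 2))" using monic by force
  ultimately show "?p = ?q ^ (N div 2)" by blast
qed

theorem char_poly_hashimoto_mat:
  assumes k: "k \<ge> 2"
  shows "char_poly (hashimoto_mat :: complex mat) = [:- 1, 0, 1:] ^ (n * (k - 2) div 2) *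
    (\<Prod>l \<in># proots (char_poly (adj_mat :: complex mat)). [:of_nat k - 1, - l, 1:])"
    (is "?p = _ * ?Q")
proof -
  let ?q = "[:- 1, 0, 1:] :: complex poly" and ?A = "adj_mat :: complex mat"
  let ?L = "proots (char_poly ?A)"
  define m where "m = N div 2"
  have m2: "N = 2 * m" using even_arcs by (simp add: m_def)
  \<comment> \<open>This avoids truncated subtraction in \<open>k - 2\<close>. With \<open>m\<close>
    the number of edges, \<open>m - n\<close> is the exponent in the formula.\<close>
  obtain j where "k = 2 + j" using k le_Suc_ex by blast
  then have "n * (k - 2) + 2 * n = N"
    by (simp add: card_arcs algebra_simps)
  then have "n * (k - 2) = 2 * (m - n)" and "n \<le> m" using m2 by linarith+
  then have m: "m = n * (k - 2) div 2 + n" by simp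
  have deg: "degree (char_poly ?A) = n" and monic: "lead_coeff (char_poly ?A) = 1"
    using degree_monic_char_poly[of ?A n] by auto
  have size: "size ?L = n" using deg by (simp add: size_proots_complex)
  have fac: "char_poly ?A = (\<Prod>l \<in># ?L. [:- l, 1:])"
    using complex_poly_decompose_multiset[of "char_poly ?A"] monic by simp
  \<comment> \<open>The cancelled power collects \<open>n\<close> factors from Sylvester's identity
    and \<open>m\<close> from the determinant of \<open>z - J\<close>. The point 0 is left out
    because \<open>w\<close> below divides by \<open>z\<close>.\<close>
  have "?q ^ (n + m) * ?p = ?q ^ (n + m) * (?q ^ (n * (k - 2) div 2) * ?Q)"
  proof (rule poly_eqI_cofinite[of "{0}"])
    fix z :: complex assume "z \<notin> {0}"
    then have z: "z \<noteq> 0" by simp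
    \<comment> \<open>At this point the vertex determinant is \<open>z ^ n\<close> times the
      characteristic polynomial of \<open>A\<close>, and each factor \<open>z * (w - l)\<close> is
      the quadratic belonging to \<open>l\<close>.\<close>
    define w where "w = (z\<^sup>2 - 1 + of_nat k) / z"
    have zw: "z * w = z\<^sup>2 - 1 + of_nat k" using z by (simp add: w_def)
    have "(z\<^sup>2 - 1 + of_nat k) \<cdot>\<^sub>m 1\<^sub>m n - z \<cdot>\<^sub>m ?A = z \<cdot>\<^sub>m (w \<cdot>\<^sub>m 1\<^sub>m n - ?A)"
      by (rule eq_matI) (auto simp: algebra_simps zw[unfolded mult.commute[of z w]] zw)
    then have "det ((z\<^sup>2 - 1 + of_nat k) \<cdot>\<^sub>m 1\<^sub>m n - z \<cdot>\<^sub>m ?A) = z ^ n * poly (char_poly ?A) w"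
      by (simp add: poly_char_poly_eq_det[of _ n])
    also have "\<dots> = (\<Prod>l \<in># ?L. z * (w - l))"
      by (subst fac) (simp add: poly_prod_mset image_mset.compositionality o_def
          prod_mset.distrib size)
    also have "(\<Prod>l \<in># ?L. z * (w - l)) = poly ?Q z"
    proof -
      have "z * (w - l) = poly [:of_nat k - 1, - l, 1:] z" for l
        unfolding right_diff_distrib zw by (simp add: power2_eq_square algebra_simps)
      then show ?thesis
        by (simp add: poly_prod_mset image_mset.compositionality o_def del: poly_pCons)
    qed
    finally have D: "det ((z\<^sup>2 - 1 + of_nat k) \<cdot>\<^sub>m 1\<^sub>m n - z \<cdot>\<^sub>m ?A) = poly ?Q z" .
    have q: "poly ?q z = z\<^sup>2 - 1" by (simp add: power2_eq_square)
    have J: "det (z \<cdot>\<^sub>m 1\<^sub>m N - rev_mat) = (z\<^sup>2 - 1) ^ m"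
      using arg_cong[OF char_poly_rev_mat, of "\<lambda>p. poly p z"]
      by (simp add: poly_char_poly_eq_det[of _ N] m_def poly_power q del: poly_pCons)
    have "poly (?q ^ (n + m) * ?p) z = (z\<^sup>2 - 1) ^ N * poly ?Q z"
      using det_hashimoto_mat[of z] unfolding J D
      by (simp add: poly_char_poly_eq_det[of _ N] poly_power q power_add mult_ac del: poly_pCons)
    also have "\<dots> = (z\<^sup>2 - 1) ^ (n + m + n * (k - 2) div 2) * poly ?Q z"
      using m m2 by (intro arg_cong[where f = "\<lambda>x. (z\<^sup>2 - 1) ^ x * poly ?Q z"]) linarith
    finally show "poly (?q ^ (n + m) * ?p) z
        = poly (?q ^ (n + m) * (?q ^ (n * (k - 2) div 2) * ?Q)) z"
      by (simp add: poly_power q power_add mult_ac del: poly_pCons)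
  qed simp
  moreover have "?q ^ (n + m) \<noteq> 0" by simp
  ultimately show ?thesis using mult_left_cancel by blast
qed

end

end

section \<open>The positive support of the transition matrix\<close>

lemma pair_graph_arcs:
  assumes "pair_graph G" and "(u, v) \<in> parcs G"
  shows "u \<in> pverts G" and "v \<in> pverts G" and "(v, u) \<in> parcs G" and "u \<noteq> v"
proof -
  interpret pair_graph G by fact
  show "u \<in> pverts G" "v \<in> pverts G" "(v, u) \<in> parcs G" "u \<noteq> v"
    using assms(2) in_arcsD1 in_arcsD2 arcs_symmetric no_loops' by blast+
qed

text \<open>Arcs are symmetric, so connectedness is strong connectedness and a property can be
  propagated along directed arcs.\<close>

lemma connected_pair_graph_induct:
  assumes "pair_graph G" and "Digraph_Component.connected (with_proj G)"
    and "u \<in> pverts G" and "v \<in> pverts G" and "P u"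
    and step: "\<And>x y. (x, y) \<in> parcs G \<Longrightarrow> P x \<Longrightarrow> P y"
  shows "P v"
proof -
  interpret pair_graph G by fact
  have "strongly_connected (with_proj G)"
    using assms(2) sym_arcs by (intro symmetric_connected_imp_strongly_connected)
  then have "u \<rightarrow>\<^sup>*\<^bsub>with_proj G\<^esub> v"
    using assms(3,4) by (simp add: strongly_connected_def)
  then show ?thesis
    by (induction rule: reachable_induct) (use \<open>P u\<close> step in auto)
qed

text \<open>Any square root of the discriminant splits the quadratic; \<open>csqrt\<close> fixes
  one, and both signs are listed.\<close>

lemma proots_quadratic:
  fixes l c :: complex
  shows "proots [:c, - l, 1:] =
    {# (l + csqrt (l ^ 2 - 4 * c)) / 2, (l - csqrt (l ^ 2 - 4 * c)) / 2 #}"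
proof -
  define s where "s = csqrt (l ^ 2 - 4 * c)"
  have s2: "s * s = l\<^sup>2 - 4 * c"
    unfolding s_def using power2_csqrt[of "l ^ 2 - 4 * c"] by (simp add: power2_eq_square)
  have "[:c, - l, 1:] = [:- ((l + s) / 2), 1:] * [:- ((l - s) / 2), 1:]"
    using s2 by (simp add: field_simps power2_eq_square)
  also have "proots \<dots> = proots [:- ((l + s) / 2), 1:] + proots [:- ((l - s) / 2), 1:]"
    by (rule proots_mult) auto
  finally show ?thesis by (simp add: s_def)
qed

section \<open>Matrices of a graph given by lists of vertices and arcs\<close>

lemma sum_adjacency_row:
  assumes "pair_graph G" and "regular_graph G k" and vs: "distinct vs" "set vs = pverts G"
    and i: "i < length vs"
  shows "(\<Sum>j<length vs. adjacency_matrix G vs $$ (i, j)) = real k"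
proof -
  have "(\<Sum>j<length vs. adjacency_matrix G vs $$ (i, j))
      = (\<Sum>j<length vs. of_bool ((vs ! i, vs ! j) \<in> parcs G))"
    using i by (intro sum.cong) (auto simp: adjacency_matrix_def)
  also have "\<dots> = real (card {j. j < length vs \<and> (vs ! i, vs ! j) \<in> parcs G})"
    by (simp add: lessThan_def Collect_conj_eq)
  also have "bij_betw (\<lambda>j. (vs ! i, vs ! j)) {j. j < length vs \<and> (vs ! i, vs ! j) \<in> parcs G}
      {e \<in> parcs G. fst e = vs ! i}"
  proof (rule bij_betw_imageI)
    show "inj_on (\<lambda>j. (vs ! i, vs ! j)) {j. j < length vs \<and> (vs ! i, vs ! j) \<in> parcs G}"
      using vs(1) by (auto simp: inj_on_def nth_eq_iff_index_eq)
    have "(u, v) \<in> (\<lambda>j. (vs ! i, vs ! j)) ` {j. j < length vs \<and> (vs ! i, vs ! j) \<in> parcs G}"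
      if "(u, v) \<in> parcs G" "u = vs ! i" for u v
    proof -
      have "v \<in> set vs" using pair_graph_arcs(2)[OF assms(1) that(1)] vs(2) by simp
      then obtain j where "j < length vs" "v = vs ! j" by (auto simp: in_set_conv_nth)
      then show ?thesis using that by auto
    qed
    then show "(\<lambda>j. (vs ! i, vs ! j)) ` {j. j < length vs \<and> (vs ! i, vs ! j) \<in> parcs G}
        = {e \<in> parcs G. fst e = vs ! i}"
      by force
  qed
  then have "card {j. j < length vs \<and> (vs ! i, vs ! j) \<in> parcs G}
      = card {e \<in> parcs G. fst e = vs ! i}"
    by (rule bij_betw_same_card)
  also have "\<dots> = degree_of G (vs ! i)"
    by (simp add: degree_of_def out_degree_def out_arcs_def)
  also have "\<dots> = k"
    using \<open>regular_graph G k\<close> i vs(2) nth_mem unfolding regular_graph_def by blast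
  finally show ?thesis .
qed

text \<open>A harmonic function agrees at the two ends of every arc, hence is constant by
  connectedness.\<close>

lemma order_char_poly_adjacency_matrix:
  assumes "pair_graph G" and "Digraph_Component.connected (with_proj G)"
    and "regular_graph G k" and vs: "distinct vs" "set vs = pverts G"
  shows "order (of_nat k) (char_poly (map_mat complex_of_real (adjacency_matrix G vs))) = 1"
proof -
  let ?A = "adjacency_matrix G vs" and ?n = "length vs"
  have "pverts G \<noteq> {}" using assms(2) by (simp add: connected_conv)
  then have "vs \<noteq> []" using vs(2) by auto
  have sym: "?A $$ (i, j) = ?A $$ (j, i)" if "i < ?n" "j < ?n" for i j
    using that pair_graph_arcs(3)[OF assms(1)] by (auto simp: adjacency_matrix_def)
  note row = sum_adjacency_row[OF assms(1,3) vs]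
  have "order (complex_of_real (real k)) (char_poly (map_mat complex_of_real ?A)) = 1"
  proof (rule order_char_poly_simple_eigenvalue)
    show "?A \<in> carrier_mat ?n ?n" by (simp add: adjacency_matrix_def)
    show "0 < ?n" using \<open>vs \<noteq> []\<close> by simp
    show "(\<Sum>j<?n. ?A $$ (i, j)) = real k" if "i < ?n" for i by (rule row[OF that])
    fix f :: "nat \<Rightarrow> real" and i j
    assume harm: "\<And>i. i < ?n \<Longrightarrow> (\<Sum>j<?n. ?A $$ (i, j) * f j) = real k * f i"
      and ij: "i < ?n" "j < ?n"
    have adj: "f a = f b" if "a < ?n" "b < ?n" "(vs ! a, vs ! b) \<in> parcs G" for a b
    proof (rule weighted_harmonic_imp_eq[where n = ?n and a = "\<lambda>i j. ?A $$ (i, j)" and k = "real k"])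
      show "(\<Sum>j<?n. ?A $$ (i, j)) = real k" if "i < ?n" for i by (rule row[OF that])
      show "?A $$ (i, j) = ?A $$ (j, i)" if "i < ?n" "j < ?n" for i j by (rule sym[OF that])
      show "(\<Sum>j<?n. ?A $$ (i, j) * f j) = real k * f i" if "i < ?n" for i
        by (rule harm[OF that])
    qed (use that in \<open>auto simp: adjacency_matrix_def\<close>)
    have "vs ! i \<in> pverts G" "vs ! j \<in> pverts G" using ij vs(2) nth_mem by blast+
    \<comment> \<open>The function \<open>f\<close> lives on list positions while the induction runs
      over vertices, so the invariant quantifies over the positions of a vertex.\<close>
    then have "\<forall>b < ?n. vs ! b = vs ! j \<longrightarrow> f i = f b"
    proof (rule connected_pair_graph_induct[OF assms(1,2)])
      show "\<forall>b < ?n. vs ! b = vs ! i \<longrightarrow> f i = f b"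
        using ij vs(1) by (auto simp: nth_eq_iff_index_eq)
      fix x y assume xy: "(x, y) \<in> parcs G" and IH: "\<forall>b < ?n. vs ! b = x \<longrightarrow> f i = f b"
      have "x \<in> set vs" using pair_graph_arcs(1)[OF assms(1) xy] vs(2) by simp
      then obtain a where "a < ?n" "x = vs ! a" by (auto simp: in_set_conv_nth)
      then show "\<forall>b < ?n. vs ! b = y \<longrightarrow> f i = f b" using IH adj[of a] xy by metis
    qed
    then show "f i = f j" using ij by blast
  qed (rule sym)
  then show ?thesis by simp
qed

text \<open>Translation to positions: \<open>t\<close> sends an arc to the position of its tail in
  \<open>vs\<close>, and \<open>\<sigma>\<close> to the position of its reverse in
  \<open>es\<close>.\<close>

lemma regular_graph_arc_indexing:
  assumes "pair_graph G" and reg: "regular_graph G k" and k: "k \<ge> 2"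
    and vs: "distinct vs" "set vs = pverts G" and es: "distinct es" "set es = parcs G"
  obtains t \<sigma> where "regular_multigraph (length es) (length vs) k t \<sigma>"
    and "map_mat complex_of_real (adjacency_matrix G vs)
      = adj_mat (length es) (length vs) t \<sigma>"
    and "map_mat complex_of_real (positive_support (transition_matrix G es))
      = hashimoto_mat (length es) t \<sigma>"
proof -
  note arcs = pair_graph_arcs[OF assms(1)]
  define N where "N = length es"
  define n where "n = length vs"
  have n: "length vs = n" by (simp add: n_def)
  have "\<exists>a<n. vs ! a = fst (es ! i)" if "i < N" for i
  proof -
    have "es ! i \<in> parcs G" using that es(2) nth_mem unfolding N_def by blast
    then have "fst (es ! i) \<in> set vs" using arcs(1) vs(2) by (metis prod.collapse)
    then show ?thesis using n by (auto simp: in_set_conv_nth)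
  qed
  then obtain t where t: "\<And>i. i < N \<Longrightarrow> t i < n \<and> vs ! t i = fst (es ! i)" by metis
  have "\<exists>j<N. es ! j = prod.swap (es ! i)" if "i < N" for i
  proof -
    have "es ! i \<in> parcs G" using that es(2) nth_mem unfolding N_def by blast
    then have "prod.swap (es ! i) \<in> set es"
      using arcs(3) es(2) by (metis prod.swap_def prod.collapse)
    then show ?thesis unfolding N_def by (auto simp: in_set_conv_nth)
  qed
  then obtain \<sigma> where \<sigma>: "\<And>i. i < N \<Longrightarrow> \<sigma> i < N \<and> es ! \<sigma> i = prod.swap (es ! i)" by metis
  have es_inj: "es ! i = es ! j \<longleftrightarrow> i = j" if "i < N" "j < N" for i j
    using that es(1) by (simp add: N_def nth_eq_iff_index_eq)
  have vs_inj: "vs ! i = vs ! j \<longleftrightarrow> i = j" if "i < n" "j < n" for i j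
    using that vs(1) n by (simp add: nth_eq_iff_index_eq)
  have es_arc: "es ! i \<in> parcs G" if "i < N" for i
    using that es(2) nth_mem unfolding N_def by blast
  have deg: "degree_of G v = k" if "v \<in> pverts G" for v
    using reg that by (simp add: regular_graph_def)
  have tail: "t i = v \<longleftrightarrow> fst (es ! i) = vs ! v" if "i < N" "v < n" for i v
    using t[OF that(1)] vs_inj that by metis
  have head: "t (\<sigma> i) = v \<longleftrightarrow> snd (es ! i) = vs ! v" if "i < N" "v < n" for i v
    using tail[of "\<sigma> i" v] \<sigma>[OF that(1)] that by simp
  have "regular_multigraph N n k t \<sigma>"
    unfolding regular_multigraph_def
  proof (intro conjI allI impI)
    fix i assume i: "i < N"
    show "t i < n" using t i by blast
    show "\<sigma> i < N" using \<sigma> i by blast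
    then show "\<sigma> (\<sigma> i) = i" using es_inj \<sigma> i by (metis swap_swap)
    show "\<sigma> i \<noteq> i" using \<sigma>[OF i] es_arc[OF i] arcs(4) by (metis fst_swap prod.collapse snd_swap)
  next
    fix v assume v: "v < n"
    have "bij_betw ((!) es) {i. i < N \<and> t i = v} {e \<in> parcs G. fst e = vs ! v}"
    proof (rule bij_betw_imageI)
      show "inj_on ((!) es) {i. i < N \<and> t i = v}" using es_inj by (auto simp: inj_on_def)
      show "(!) es ` {i. i < N \<and> t i = v} = {e \<in> parcs G. fst e = vs ! v}"
      proof (intro subset_antisym subsetI)
        fix e assume "e \<in> {e \<in> parcs G. fst e = vs ! v}"
        then have "e \<in> set es" and "fst e = vs ! v" using es(2) by auto
        then obtain i where "i < N" "es ! i = e" "fst e = vs ! v"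
          by (auto simp: N_def in_set_conv_nth)
        then show "e \<in> (!) es ` {i. i < N \<and> t i = v}" using tail[OF _ v] by blast
      next
        fix e assume "e \<in> (!) es ` {i. i < N \<and> t i = v}"
        then show "e \<in> {e \<in> parcs G. fst e = vs ! v}" using tail[OF _ v] es_arc by blast
      qed
    qed
    then have "card {i. i < N \<and> t i = v} = card {e \<in> parcs G. fst e = vs ! v}"
      by (rule bij_betw_same_card)
    also have "\<dots> = degree_of G (vs ! v)"
      by (simp add: degree_of_def out_degree_def out_arcs_def)
    also have "\<dots> = k" using deg v n vs(2) nth_mem by blast
    finally show "card {i. i < N \<and> t i = v} = k" .
  qed
  have adj: "map_mat complex_of_real (adjacency_matrix G vs) = adj_mat N n t \<sigma>"
  proof (rule eq_matI)
    fix u v assume "u < dim_row (adj_mat N n t \<sigma> :: complex mat)" "v < dim_col (adj_mat N n t \<sigma> :: complex mat)"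
    then have uv: "u < n" "v < n" by auto
    have eq: "{i. i < N \<and> t i = u \<and> t (\<sigma> i) = v} = {i. i < N \<and> es ! i = (vs ! u, vs ! v)}"
      using tail head uv by (auto simp: prod_eq_iff)
    \<comment> \<open>An arc is determined by its ends and \<open>es\<close> is distinct, so the arc
      count is 0 or 1.\<close>
    have "card {i. i < N \<and> es ! i = (vs ! u, vs ! v)} = of_bool ((vs ! u, vs ! v) \<in> parcs G)"
    proof (cases "(vs ! u, vs ! v) \<in> parcs G")
      case True
      then obtain i where i: "i < N" "es ! i = (vs ! u, vs ! v)"
        using es(2) by (metis N_def in_set_conv_nth)
      have "x = i" if "x < N" "es ! x = (vs ! u, vs ! v)" for x
        using es_inj[OF that(1) i(1)] i(2) that(2) by simp
      with i have "{i. i < N \<and> es ! i = (vs ! u, vs ! v)} = {i}" by blast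
      then show ?thesis using True by simp
    next
      case False
      then have "{i. i < N \<and> es ! i = (vs ! u, vs ! v)} = {}" using es_arc by force
      then show ?thesis using False by simp
    qed
    then show "map_mat complex_of_real (adjacency_matrix G vs) $$ (u, v) = adj_mat N n t \<sigma> $$ (u, v)"
      using uv by (simp add: adjacency_matrix_def adj_mat_def eq n)
  qed (simp_all add: adjacency_matrix_def n)
  have supp: "map_mat complex_of_real (positive_support (transition_matrix G es)) = hashimoto_mat N t \<sigma>"
  proof (rule eq_matI)
    fix i j assume "i < dim_row (hashimoto_mat N t \<sigma> :: complex mat)"
      "j < dim_col (hashimoto_mat N t \<sigma> :: complex mat)"
    then have ij: "i < N" "j < N" by auto
    obtain w x u v where e: "es ! i = (w, x)" "es ! j = (u, v)" by fastforce
    have "t i = t (\<sigma> j) \<longleftrightarrow> v = w"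
      using head[of j "t i"] t[OF ij(1)] e ij by auto
    moreover have "j = \<sigma> i \<longleftrightarrow> u = x \<and> v = w"
      using es_inj[of j "\<sigma> i"] \<sigma>[OF ij(1)] e ij by auto
    moreover have "degree_of G v = k"
      using deg[of v] es_arc[OF ij(2)] arcs(2) e by simp
    \<comment> \<open>This is where \<open>k \<ge> 2\<close> turns the support into the
      non-backtracking matrix: the backtracking entry \<open>2 / k - 1\<close> is not positive,
      while \<open>2 / k\<close> is.\<close>
    moreover have "2 / real k > 0" "2 / real k - 1 \<le> 0" using k by auto
    ultimately show "map_mat complex_of_real (positive_support (transition_matrix G es)) $$ (i, j)
        = hashimoto_mat N t \<sigma> $$ (i, j)"
      using ij e
      by (auto simp: positive_support_def transition_matrix_def hashimoto_mat_def
          simp flip: N_def)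
  qed (simp_all add: positive_support_def transition_matrix_def flip: N_def)
  show thesis
    using that \<open>regular_multigraph N n k t \<sigma>\<close> adj supp unfolding N_def n_def by blast
qed

theorem theorem3p1:
  fixes G :: "'a pair_pre_digraph"
    and n k :: nat
    and vs :: "'a list"
    and es :: "('a \<times> 'a) list"
  assumes "pair_graph G"
    and "Digraph_Component.connected (with_proj G)"
    and "regular_graph G k"
    and "card (pverts G) = n"
    and "k \<ge> 2"
    and "distinct vs" and "set vs = pverts G"
    and "distinct es" and "set es = parcs G"
  shows "size (complex_eigenvalues (positive_support (transition_matrix G es))) = n * k \<and>
    complex_eigenvalues (positive_support (transition_matrix G es)) =
      {# of_nat k - 1 #}
      + (\<Sum>l \<in># {# l \<in># complex_eigenvalues (adjacency_matrix G vs). l \<noteq> of_nat k #}.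
           {# (l + csqrt (l ^ 2 - 4 * (of_nat k - 1))) / 2,
              (l - csqrt (l ^ 2 - 4 * (of_nat k - 1))) / 2 #})
      + replicate_mset (n * (k - 2) div 2 + 1) 1
      + replicate_mset (n * (k - 2) div 2) (- 1)"
proof -
  have n: "length vs = n" using assms(4,6,7) distinct_card by metis
  obtain t \<sigma> where mg: "regular_multigraph (length es) n k t \<sigma>"
    and adj: "map_mat complex_of_real (adjacency_matrix G vs)
      = adj_mat (length es) n t \<sigma>"
    and supp: "map_mat complex_of_real (positive_support (transition_matrix G es))
      = hashimoto_mat (length es) t \<sigma>"
    using regular_graph_arc_indexing[OF assms(1,3,5-9)] unfolding n by metis
  let ?A = "adj_mat (length es) n t \<sigma> :: complex mat"
    and ?B = "hashimoto_mat (length es) t \<sigma> :: complex mat"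
  define c :: complex where "c = of_nat k - 1"
  let ?L = "complex_eigenvalues (adjacency_matrix G vs)" and ?e = "n * (k - 2) div 2"
  let ?f = "\<lambda>l. proots [:c, - l, 1:]"
  have L: "?L = proots (char_poly ?A)"
    by (simp add: complex_eigenvalues_def adj)
  have "char_poly ?A \<noteq> 0"
    using degree_monic_char_poly[of ?A n] by force
  \<comment> \<open>Filtering out \<open>k\<close> therefore removes exactly one quadratic factor,
    which is split off separately.\<close>
  then have "count ?L (of_nat k) = 1"
    using order_char_poly_adjacency_matrix[OF assms(1-3,6,7)] by (simp add: L adj)
  then have Lk: "{# l \<in># ?L. \<not> l \<noteq> of_nat k #} = {# of_nat k #}"
    by (simp add: filter_eq_replicate_mset)
  have L_split: "?L = {# l \<in># ?L. l \<noteq> of_nat k #} + {# of_nat k #}"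
    by (rule trans[OF multiset_partition[of ?L "\<lambda>l. l \<noteq> of_nat k"]]) (simp only: Lk)
  \<comment> \<open>The factor for \<open>k\<close> has the roots 1 and \<open>k - 1\<close>: the
    latter is item (i), the former the additional 1 in item (iii).\<close>
  have "?f (of_nat k) = proots ([:- 1, 1:] * [:- c, 1:])" by (simp add: c_def)
  also have "\<dots> = proots [:- 1, 1:] + proots [:- c, 1:]" by (rule proots_mult) auto
  finally have fk: "?f (of_nat k) = {# 1, c #}" by simp
  have sq: "proots ([:- 1, 0, 1:] :: complex poly) = {# 1, - 1 #}"
    using proots_quadratic[of "- 1" 0] by simp
  have prod: "proots (\<Prod>l \<in># M. [:c, - l, 1:]) = (\<Sum>l \<in># M. ?f l)" for M
  proof (induction M)
    case (add l M)
    have "(\<Prod>l \<in># M. [:c, - l, 1:]) \<noteq> 0" by (auto simp: prod_mset_zero_iff)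
    then have "proots ([:c, - l, 1:] * (\<Prod>l \<in># M. [:c, - l, 1:]))
        = ?f l + proots (\<Prod>l \<in># M. [:c, - l, 1:])"
      by (intro proots_mult) auto
    then show ?case using add.IH by (simp del: mult_pCons_left)
  qed simp
  have "proots (char_poly ?B)
      = repeat_mset ?e {# 1, - 1 #} + (\<Sum>l \<in># ?L. ?f l)"
    unfolding char_poly_hashimoto_mat[OF mg assms(5)] L[symmetric] c_def[symmetric]
      sq[symmetric] prod[symmetric] proots_power[symmetric]
    by (rule proots_mult) (auto simp: prod_mset_zero_iff)
  also have "repeat_mset ?e {# 1, - 1 #} = replicate_mset ?e 1 + replicate_mset ?e (- 1 :: complex)"
    by (rule multiset_eqI) simp
  also have "(\<Sum>l \<in># ?L. ?f l) = (\<Sum>l \<in># {# l \<in># ?L. l \<noteq> of_nat k #}. ?f l) + {# 1, c #}"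
    by (rule trans[OF arg_cong[OF L_split, of "\<lambda>M. \<Sum>l \<in># M. ?f l"]]) (simp add: fk)
  finally have "proots (char_poly ?B)
      = (replicate_mset ?e 1 + replicate_mset ?e (- 1))
        + ((\<Sum>l \<in># {# l \<in># ?L. l \<noteq> of_nat k #}. ?f l) + {# 1, c #})" .
  \<comment> \<open>Regrouping: the root 1 of the factor for \<open>k\<close> joins the copies of 1
    coming from the power of \<open>z\<^sup>2 - 1\<close>.\<close>
  moreover have "(R + T) + (S + {# 1, c #}) = {# c #} + S + add_mset 1 R + T"
    for R S T :: "complex multiset"
    by (simp add: ac_simps)
  ultimately have eq: "proots (char_poly ?B)
      = {# c #} + (\<Sum>l \<in># {# l \<in># ?L. l \<noteq> of_nat k #}. ?f l)
        + add_mset 1 (replicate_mset ?e 1) + replicate_mset ?e (- 1)"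
    by (simp only:)
  have deg: "degree (char_poly ?B) = length es"
    by (simp add: degree_monic_char_poly[OF mat_carriers(2)])
  have "size (proots (char_poly ?B)) = n * k"
    unfolding size_proots_complex deg by (rule card_arcs[OF mg])
  then show ?thesis
    unfolding complex_eigenvalues_def[of "positive_support _"] supp
      Suc_eq_plus1[symmetric] replicate_mset_Suc
    using eq[unfolded proots_quadratic c_def] by (rule conjI)
qed

end
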